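(* Let $A\in\mathbb{R}^{m\times n}$, $b\in\mathbb{R}^m$, $p\in\{1,2\}$, and let $\phi:\mathbb{R}_+\to\mathbb{R}_+$ be continuous and nondecreasing with $\phi(0)=0$. Let $L$ and $s_i,\rho_i,\Omega_i$ ($i\in\mathbb{N}_L^0$) be the objects produced by the iteration described in the context, and let $f_i(\lambda):=s_i+\lambda\rho_i$ for $\lambda\ge 0$, $i\in\mathbb{N}_L^0$. Then the optimal solution set of the problem $$\min\{\|x\|_0+\lambda\phi(\|Ax-b\|_p):x\in\mathbb{R}^n\}\qquad(\ast)$$ is nonempty for any $\lambda>0$. Furthermore, for any fixed $\lambda>0$: (i) the optimal value of $(\ast)$ is $\min\{f_i(\lambda):i\in\mathbb{N}_L^0\}$; (ii) the optimal solution set of $(\ast)$ is $\bigcup_{i\in\Lambda^*}\Omega_i$, where $\Lambda^*:=\arg\min\{f_i(\lambda):i\in\mathbb{N}_L^0\}$.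
   Context: $\mathbb{R}_+=[0,+\infty)$; $\mathbb{N}_k^0=\{0,1,\dots,k\}$; $\|x\|_0$ is the number of nonzero components of $x$; "optimal solution set" means the set of all global minimizers; $\arg\min$ denotes the set of all minimizers. Iteration (depending on $A,b,p,\phi$). Set $i=0$ and $\rho_0:=\min\{\phi(\|Ax-b\|_p):x\in\mathbb{R}^n\}$, $s_0:=\min\{\|x\|_0:\phi(\|Ax-b\|_p)=\rho_0,\ x\in\mathbb{R}^n\}$, $\Omega_0:=\arg\min\{\|x\|_0:\phi(\|Ax-b\|_p)=\rho_0,\ x\in\mathbb{R}^n\}$. While $s_i>0$: put $\rho_{i+1}:=\min\{\phi(\|Ax-b\|_p):\|x\|_0\le s_i-1,\ x\in\mathbb{R}^n\}$, $s_{i+1}:=\min\{\|x\|_0:\phi(\|Ax-b\|_p)=\rho_{i+1},\ x\in\mathbb{R}^n\}$, $\Omega_{i+1}:=\arg\min\{\|x\|_0:\phi(\|Ax-b\|_p)=\rho_{i+1},\ x\in\mathbb{R}^n\}$, and replace $i$ by $i+1$. When the loop ends (i.e. $s_i=0$), set $L:=i$. (All these minima are attained and the iteration terminates.) *)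

theory Defs
  imports "HOL-Analysis.Analysis"
begin

definition l0 :: "real ^ 'n \<Rightarrow> nat" where
  "l0 x = card {j. x $ j \<noteq> 0}"

definition lp_norm :: "nat \<Rightarrow> real ^ 'm \<Rightarrow> real" where
  "lp_norm p y = root p (\<Sum>j\<in>UNIV. \<bar>y $ j\<bar> ^ p)"

(* Least, rather than Min or Inf: the sets below may be infinite, and the minimum of S is
   meant to be an element of S. *)
definition minimum :: "'a::linorder set \<Rightarrow> 'a" where
  "minimum S = (LEAST v. v \<in> S)"

definition minimizers :: "('a \<Rightarrow> 'b::linorder) \<Rightarrow> 'a set \<Rightarrow> 'a set" where
  "minimizers F S = {x. is_arg_min F (\<lambda>y. y \<in> S) x}"

definition loss :: "real ^ 'n ^ 'm \<Rightarrow> real ^ 'm \<Rightarrow> nat \<Rightarrow> (real \<Rightarrow> real) \<Rightarrow> real ^ 'n \<Rightarrow> real" where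
  "loss A b p \<phi> x = \<phi> (lp_norm p (A *v x - b))"

definition min_l0_at_loss ::
  "real ^ 'n ^ 'm \<Rightarrow> real ^ 'm \<Rightarrow> nat \<Rightarrow> (real \<Rightarrow> real) \<Rightarrow> real \<Rightarrow> nat" where
  "min_l0_at_loss A b p \<phi> r = minimum (l0 ` {x. loss A b p \<phi> x = r})"

(* The sequences run over all natural numbers; only the indices up to iter_L belong to the
   iteration.  For i < iter_L we have iter_s i > 0, so the natural-number subtraction below
   does not truncate there. *)
primrec iter_rho ::
  "real ^ 'n ^ 'm \<Rightarrow> real ^ 'm \<Rightarrow> nat \<Rightarrow> (real \<Rightarrow> real) \<Rightarrow> nat \<Rightarrow> real" where
  "iter_rho A b p \<phi> 0 = minimum (range (loss A b p \<phi>))"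
| "iter_rho A b p \<phi> (Suc i) =
     minimum (loss A b p \<phi> ` {x. l0 x \<le> min_l0_at_loss A b p \<phi> (iter_rho A b p \<phi> i) - 1})"

definition iter_s ::
  "real ^ 'n ^ 'm \<Rightarrow> real ^ 'm \<Rightarrow> nat \<Rightarrow> (real \<Rightarrow> real) \<Rightarrow> nat \<Rightarrow> nat" where
  "iter_s A b p \<phi> i = min_l0_at_loss A b p \<phi> (iter_rho A b p \<phi> i)"

definition iter_Omega ::
  "real ^ 'n ^ 'm \<Rightarrow> real ^ 'm \<Rightarrow> nat \<Rightarrow> (real \<Rightarrow> real) \<Rightarrow> nat \<Rightarrow> (real ^ 'n) set" where
  "iter_Omega A b p \<phi> i = minimizers l0 {x. loss A b p \<phi> x = iter_rho A b p \<phi> i}"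

definition iter_L :: "real ^ 'n ^ 'm \<Rightarrow> real ^ 'm \<Rightarrow> nat \<Rightarrow> (real \<Rightarrow> real) \<Rightarrow> nat" where
  "iter_L A b p \<phi> = (LEAST i. iter_s A b p \<phi> i = 0)"

definition iter_f ::
  "real ^ 'n ^ 'm \<Rightarrow> real ^ 'm \<Rightarrow> nat \<Rightarrow> (real \<Rightarrow> real) \<Rightarrow> nat \<Rightarrow> real \<Rightarrow> real" where
  "iter_f A b p \<phi> i t = real (iter_s A b p \<phi> i) + t * iter_rho A b p \<phi> i"

definition objective ::
  "real ^ 'n ^ 'm \<Rightarrow> real ^ 'm \<Rightarrow> nat \<Rightarrow> (real \<Rightarrow> real) \<Rightarrow> real \<Rightarrow> real ^ 'n \<Rightarrow> real" where
  "objective A b p \<phi> t x = real (l0 x) + t * loss A b p \<phi> x"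

end

(* Each pair (s_i, rho_i) is attained, exactly on Omega_i.  Conversely, for any x take the
   first i with s_i <= ||x||_0: as ||x||_0 < s_{i-1}, the definition of rho_i gives
   rho_i <= loss x.  So the points of the Omega_i dominate every x in both coordinates, and
   minimising the weighted sum reduces to the finitely many pairs.  The minima defining rho_i are
   attained because {x. ||x||_0 <= k} is a finite union of subspaces, whose images under A are closed,
   and because the p-norm is continuous and coercive. *)
theory Submission
  imports Defs
begin

section \<open>Minima and minimizers on a set\<close>

lemma minimum_eqI:
  assumes "v \<in> S" "\<And>w. w \<in> S \<Longrightarrow> v \<le> w"
  shows "minimum S = v"
  unfolding minimum_def using assms by (rule Least_equality)

lemma mem_minimizers_iff: "x \<in> minimizers F S \<longleftrightarrow> x \<in> S \<and> (\<forall>y\<in>S. F x \<le> F y)"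
  by (auto simp: minimizers_def is_arg_min_linorder)

lemma minimum_image_eq:
  assumes "x \<in> minimizers F S"
  shows "minimum (F ` S) = F x"
  using assms by (intro minimum_eqI) (auto simp: mem_minimizers_iff)

text \<open>Well-ordering of the natural numbers yields a minimizer on any nonempty set, finite or
  not; all minimizers then share its value.\<close>

lemma minimizers_eq_level:
  assumes "S \<noteq> {}"
  shows "minimizers (F :: 'a \<Rightarrow> nat) S = {x \<in> S. F x = minimum (F ` S)}"
    and "minimizers F S \<noteq> {}"
proof -
  obtain x where x: "x \<in> minimizers F S"
    using ex_has_least_nat[of "\<lambda>x. x \<in> S" _ F] assms unfolding mem_minimizers_iff by blast
  then show "minimizers F S \<noteq> {}" by blast
  from x show "minimizers F S = {x \<in> S. F x = minimum (F ` S)}"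
    unfolding minimum_image_eq[OF x] by (force simp: mem_minimizers_iff intro: antisym)
qed

lemma minimizers_finite_ne:
  assumes "finite S" "S \<noteq> {}"
  shows "minimizers F S \<noteq> {}"
proof -
  have "Min (F ` S) \<in> F ` S" using assms by simp
  then obtain x where "x \<in> S" "F x = Min (F ` S)" by auto
  then have "x \<in> minimizers F S" using assms by (auto simp: mem_minimizers_iff)
  then show ?thesis by blast
qed

subsection \<open>Attainment of the loss under a sparsity bound\<close>

text \<open>Sorting sparse vectors by a set \<open>J\<close> containing their support gives finitely
  many coordinate subspaces. The image of each is a subspace of a finite-dimensional space, hence
  closed, even when \<open>A\<close> has a kernel.\<close>

lemma closed_image_sparse:
  fixes A :: "real ^ 'n ^ 'm"
  shows "closed ((\<lambda>x. A *v x) ` {x. l0 x \<le> k})"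
proof -
  let ?V = "\<lambda>J. {x :: real ^ 'n. \<forall>j. j \<notin> J \<longrightarrow> x $ j = 0}"
  have "l0 x \<le> k \<longleftrightarrow> (\<exists>J. card J \<le> k \<and> x \<in> ?V J)" for x :: "real ^ 'n"
  proof
    assume "l0 x \<le> k"
    then show "\<exists>J. card J \<le> k \<and> x \<in> ?V J"
      by (intro exI[of _ "{j. x $ j \<noteq> 0}"]) (auto simp: l0_def)
  next
    assume "\<exists>J. card J \<le> k \<and> x \<in> ?V J"
    then obtain J where J: "card J \<le> k" "x \<in> ?V J" by blast
    then have "card {j. x $ j \<noteq> 0} \<le> card J" by (intro card_mono) auto
    with J show "l0 x \<le> k" by (simp add: l0_def)
  qed
  then have eq: "{x. l0 x \<le> k} = (\<Union>J\<in>{J. card J \<le> k}. ?V J)" by auto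
  have "closed ((\<lambda>x. A *v x) ` ?V J)" for J
    by (intro closed_subspace linear_subspace_image) (auto simp: subspace_def)
  then show ?thesis unfolding eq image_UN by (intro closed_UN) auto
qed

lemma lp_norm_nonneg: "0 \<le> lp_norm p y"
  by (simp add: lp_norm_def real_root_ge_zero sum_nonneg)

lemma continuous_on_lp_norm: "continuous_on S (lp_norm p)"
  unfolding lp_norm_def by (intro continuous_intros)

text \<open>Coercivity of \<open>lp_norm\<close>: it bounds every coordinate, and the Euclidean norm
  is at most the sum of the absolute coordinates. The crude constant serves all \<open>p\<close> at
  once.\<close>

lemma norm_le_lp_norm:
  fixes y :: "real ^ 'm"
  assumes "p > 0"
  shows "norm y \<le> real CARD('m) * lp_norm p y"
proof -
  have "\<bar>y $ j\<bar> \<le> lp_norm p y" for j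
  proof -
    have "\<bar>y $ j\<bar> ^ p \<le> (\<Sum>j\<in>UNIV. \<bar>y $ j\<bar> ^ p)"
      by (rule member_le_sum) auto
    then have "root p (\<bar>y $ j\<bar> ^ p) \<le> lp_norm p y"
      unfolding lp_norm_def using assms by simp
    then show ?thesis using assms by (simp add: real_root_power_cancel)
  qed
  then have "(\<Sum>j\<in>UNIV. \<bar>y $ j\<bar>) \<le> (\<Sum>j\<in>(UNIV :: 'm set). lp_norm p y)"
    by (intro sum_mono)
  with norm_le_l1_cart[of y] show ?thesis by simp
qed

lemma lp_norm_attains_min:
  fixes S :: "(real ^ 'm) set"
  assumes "p > 0" "closed S" "S \<noteq> {}"
  shows "\<exists>y\<in>S. \<forall>z\<in>S. lp_norm p y \<le> lp_norm p z"
proof -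
  obtain w where w: "w \<in> S" using assms by blast
  \<comment> \<open>The radius puts \<open>w\<close> into the ball, while any point outside it has a
    larger \<open>lp_norm\<close> than \<open>w\<close>. Minimising over the compact part of
    \<open>S\<close> is thus enough.\<close>
  let ?r = "real CARD('m) * lp_norm p w"
  have "compact (S \<inter> cball 0 ?r)" using assms by (simp add: closed_Int_compact)
  moreover have "w \<in> S \<inter> cball 0 ?r" using w norm_le_lp_norm[OF assms(1), of w] by simp
  ultimately obtain y where y: "y \<in> S \<inter> cball 0 ?r"
    and le: "\<forall>z \<in> S \<inter> cball 0 ?r. lp_norm p y \<le> lp_norm p z"
    using continuous_attains_inf[OF _ _ continuous_on_lp_norm, of "S \<inter> cball 0 ?r" p] by blast
  have "lp_norm p y \<le> lp_norm p z" if z: "z \<in> S" for z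
  proof (cases "norm z \<le> ?r")
    case True
    with z le show ?thesis by simp
  next
    case False
    then have "?r < real CARD('m) * lp_norm p z"
      using norm_le_lp_norm[OF assms(1), of z] by linarith
    then have "lp_norm p w \<le> lp_norm p z" by (simp add: mult_less_cancel_left)
    moreover have "lp_norm p y \<le> lp_norm p w"
      using le \<open>w \<in> S \<inter> cball 0 ?r\<close> by blast
    ultimately show ?thesis by simp
  qed
  with y show ?thesis by blast
qed

text \<open>The minimum is sought among residuals, where coercivity holds, since minimising
  sequences of \<open>x\<close> may be unbounded along the kernel of \<open>A\<close>. Monotonicity
  of \<open>\<phi>\<close> carries it over to the loss.\<close>

lemma loss_attains_min_sparse:
  fixes A :: "real ^ 'n ^ 'm"
  assumes "p > 0" "mono_on {0..} \<phi>"
  shows "minimizers (loss A b p \<phi>) {x. l0 x \<le> k} \<noteq> {}"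
proof -
  let ?S = "(\<lambda>y. - b + y) ` ((\<lambda>x. A *v x) ` {x. l0 x \<le> k})"
  have "(0 :: real ^ 'n) \<in> {x. l0 x \<le> k}" by (simp add: l0_def)
  then have "?S \<noteq> {}" by blast
  moreover have "closed ?S" by (intro closed_translation closed_image_sparse)
  ultimately obtain y where "y \<in> ?S" and le: "\<forall>z\<in>?S. lp_norm p y \<le> lp_norm p z"
    using lp_norm_attains_min[OF assms(1)] by blast
  then obtain x where x: "l0 x \<le> k" "y = A *v x - b" by auto
  have "loss A b p \<phi> x \<le> loss A b p \<phi> z" if "l0 z \<le> k" for z
  proof -
    have "lp_norm p (A *v x - b) \<le> lp_norm p (A *v z - b)"
      using le that x by force
    then show ?thesis
      unfolding loss_def by (intro mono_onD[OF assms(2)]) (auto simp: lp_norm_nonneg)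
  qed
  with x have "x \<in> minimizers (loss A b p \<phi>) {x. l0 x \<le> k}"
    by (auto simp: mem_minimizers_iff)
  then show ?thesis by blast
qed

subsection \<open>The iteration\<close>

lemma iter_rho_Suc:
  "iter_rho A b p \<phi> (Suc i) = minimum (loss A b p \<phi> ` {x. l0 x \<le> iter_s A b p \<phi> i - 1})"
  by (simp add: iter_s_def)

lemma iter_rho_attained:
  fixes A :: "real ^ 'n ^ 'm"
  assumes "p > 0" "mono_on {0..} \<phi>"
  shows iter_rho_0_attained:
      "\<exists>x. loss A b p \<phi> x = iter_rho A b p \<phi> 0" "iter_rho A b p \<phi> 0 \<le> loss A b p \<phi> y"
    and iter_rho_Suc_attained:
      "\<exists>x. l0 x \<le> iter_s A b p \<phi> i - 1 \<and> loss A b p \<phi> x = iter_rho A b p \<phi> (Suc i)"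
      "l0 y \<le> iter_s A b p \<phi> i - 1 \<Longrightarrow> iter_rho A b p \<phi> (Suc i) \<le> loss A b p \<phi> y"
proof -
  \<comment> \<open>The unconstrained problem defining \<rho>_0 is the sparse one with a bound that
    every vector meets.\<close>
  have "{x :: real ^ 'n. l0 x \<le> CARD('n)} = UNIV"
    by (auto simp: l0_def intro: card_mono)
  then obtain u where u: "u \<in> minimizers (loss A b p \<phi>) UNIV"
    using loss_attains_min_sparse[OF assms, of A b "CARD('n)"] by auto
  from minimum_image_eq[OF u] u
  show "\<exists>x. loss A b p \<phi> x = iter_rho A b p \<phi> 0" "iter_rho A b p \<phi> 0 \<le> loss A b p \<phi> y"
    by (auto simp: mem_minimizers_iff)
  obtain v where v: "v \<in> minimizers (loss A b p \<phi>) {x. l0 x \<le> iter_s A b p \<phi> i - 1}"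
    using loss_attains_min_sparse[OF assms] by blast
  from minimum_image_eq[OF v] v
  show "\<exists>x. l0 x \<le> iter_s A b p \<phi> i - 1 \<and> loss A b p \<phi> x = iter_rho A b p \<phi> (Suc i)"
    and "l0 y \<le> iter_s A b p \<phi> i - 1 \<Longrightarrow> iter_rho A b p \<phi> (Suc i) \<le> loss A b p \<phi> y"
    unfolding iter_rho_Suc by (auto simp: mem_minimizers_iff)
qed

lemma iter_Omega_eq:
  assumes "p > 0" "mono_on {0..} \<phi>"
  shows "iter_Omega A b p \<phi> i
      = {x. loss A b p \<phi> x = iter_rho A b p \<phi> i \<and> l0 x = iter_s A b p \<phi> i}"
    and "iter_Omega A b p \<phi> i \<noteq> {}"
proof -
  have "{x. loss A b p \<phi> x = iter_rho A b p \<phi> i} \<noteq> {}"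
    using iter_rho_0_attained(1)[OF assms] iter_rho_Suc_attained(1)[OF assms]
    by (cases i) blast+
  from minimizers_eq_level[OF this, of l0]
  show "iter_Omega A b p \<phi> i
      = {x. loss A b p \<phi> x = iter_rho A b p \<phi> i \<and> l0 x = iter_s A b p \<phi> i}"
    and "iter_Omega A b p \<phi> i \<noteq> {}"
    by (simp_all add: iter_Omega_def iter_s_def min_l0_at_loss_def)
qed

lemma iter_s_le:
  assumes "loss A b p \<phi> x = iter_rho A b p \<phi> i"
  shows "iter_s A b p \<phi> i \<le> l0 x"
  unfolding iter_s_def min_l0_at_loss_def minimum_def by (rule Least_le) (use assms in auto)

text \<open>A sparse point attaining the next \<rho> competes in the minimum defining the next s.
  Once s is 0, truncated subtraction keeps it at 0.\<close>

lemma iter_s_Suc_le: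
  assumes "p > 0" "mono_on {0..} \<phi>"
  shows "iter_s A b p \<phi> (Suc i) \<le> iter_s A b p \<phi> i - 1"
  using iter_rho_Suc_attained(1)[OF assms] iter_s_le order_trans by blast

lemma iter_s_L:
  assumes "p > 0" "mono_on {0..} \<phi>"
  shows "iter_s A b p \<phi> (iter_L A b p \<phi>) = 0"
proof -
  \<comment> \<open>Each round lowers s by at least one until it reaches 0, so index s_0 is a
    witness that the \<open>LEAST\<close> defining \<open>iter_L\<close> is taken over a nonempty
    set.\<close>
  have "iter_s A b p \<phi> i \<le> iter_s A b p \<phi> 0 - i" for i
  proof (induction i)
    case (Suc i)
    with iter_s_Suc_le[OF assms, of A b i] show ?case by linarith
  qed simp
  from this[of "iter_s A b p \<phi> 0"] have "iter_s A b p \<phi> (iter_s A b p \<phi> 0) = 0" by simp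
  then show ?thesis unfolding iter_L_def by (rule LeastI)
qed

lemma iter_dominates:
  assumes "p > 0" "mono_on {0..} \<phi>"
  shows "\<exists>i\<le>iter_L A b p \<phi>. iter_s A b p \<phi> i \<le> l0 x \<and> iter_rho A b p \<phi> i \<le> loss A b p \<phi> x"
proof -
  let ?P = "\<lambda>i. iter_s A b p \<phi> i \<le> l0 x"
  define i where "i = (LEAST i. ?P i)"
  have L: "?P (iter_L A b p \<phi>)" by (simp add: iter_s_L[OF assms])
  have i: "?P i" "i \<le> iter_L A b p \<phi>"
    unfolding i_def using L by (rule LeastI, rule Least_le)
  have "iter_rho A b p \<phi> i \<le> loss A b p \<phi> x"
  proof (cases i)
    case 0
    then show ?thesis using iter_rho_0_attained(2)[OF assms] by simp
  next
    case (Suc j)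
    \<comment> \<open>Failure at \<open>j\<close> means \<open>l0 x < iter_s A b p \<phi> j\<close>,
      so s_j is positive, s_j - 1 does not truncate, and \<open>x\<close> is feasible for the next
      \<rho>.\<close>
    then have "\<not> ?P j" unfolding i_def by (intro not_less_Least) simp
    then show ?thesis unfolding Suc by (intro iter_rho_Suc_attained(2)[OF assms]) simp
  qed
  with i show ?thesis by blast
qed

section \<open>Scalarization\<close>

text \<open>Points of \<open>\<Omega> i\<close> realise the value \<open>f i\<close>, and every
  \<open>g x\<close> is bounded below by some \<open>f i\<close> with \<open>i \<le> L\<close>, with
  equality only on \<open>\<Omega> i\<close>. So both problems have the same value, and their
  minimizers correspond.\<close>

lemma dominating_pairs_scalarization:
  fixes F :: "'a \<Rightarrow> real" and c :: "'a \<Rightarrow> nat" and t :: real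
    and s :: "nat \<Rightarrow> nat" and \<rho> :: "nat \<Rightarrow> real"
  defines "g \<equiv> \<lambda>x. real (c x) + t * F x" and "f \<equiv> \<lambda>i. real (s i) + t * \<rho> i"
  assumes \<Omega>: "\<And>i. \<Omega> i = {x. F x = \<rho> i \<and> c x = s i}"
    and ne: "\<And>i. \<Omega> i \<noteq> {}"
    and dom: "\<And>x. \<exists>i\<le>L. s i \<le> c x \<and> \<rho> i \<le> F x"
    and t: "t > 0"
  shows "minimizers g UNIV = (\<Union>i \<in> minimizers f {0..L}. \<Omega> i)"
    and "minimizers g UNIV \<noteq> {}"
    and "minimum (range g) = minimum (f ` {0..L})"
proof -
  have g\<Omega>: "g x = f i" if "x \<in> \<Omega> i" for x i
    using that by (simp add: \<Omega> g_def f_def)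
  have fg: "\<exists>i\<in>{0..L}. f i \<le> g x \<and> (f i = g x \<longrightarrow> x \<in> \<Omega> i)" for x
  proof -
    obtain i where i: "i \<le> L" "s i \<le> c x" "\<rho> i \<le> F x" using dom by blast
    then have le: "real (s i) \<le> real (c x)" "t * \<rho> i \<le> t * F x" using t by simp_all
    then have "f i \<le> g x" unfolding f_def g_def by linarith
    moreover have "x \<in> \<Omega> i" if "f i = g x"
    proof -
      \<comment> \<open>A sum of two inequalities is tight only if both are; \<open>t > 0\<close>
        then cancels.\<close>
      have "real (s i) = real (c x)" "t * \<rho> i = t * F x"
        using that le unfolding f_def g_def by linarith+
      then show ?thesis using t by (simp add: \<Omega>)
    qed
    ultimately show ?thesis using i by auto
  qed
  have opt: "x \<in> minimizers g UNIV" if i: "i \<in> minimizers f {0..L}" and x: "x \<in> \<Omega> i" for i x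
  proof -
    have "f i \<le> g y" for y
    proof -
      obtain j where "j \<in> {0..L}" "f j \<le> g y" using fg[of y] by blast
      moreover from this have "f i \<le> f j" using i by (simp add: mem_minimizers_iff)
      ultimately show ?thesis by linarith
    qed
    then show ?thesis by (simp add: mem_minimizers_iff g\<Omega>[OF x])
  qed
  have "\<exists>i\<in>minimizers f {0..L}. x \<in> \<Omega> i" if x: "x \<in> minimizers g UNIV" for x
  proof -
    \<comment> \<open>This covers indices beyond \<open>L\<close> too, as every
      \<open>\<Omega> j\<close> is nonempty.\<close>
    have le: "g x \<le> f j" for j
    proof -
      obtain y where "y \<in> \<Omega> j" using ne by blast
      with x g\<Omega> show ?thesis by (metis UNIV_I mem_minimizers_iff)
    qed
    obtain i where i: "i \<in> {0..L}" "f i \<le> g x" "f i = g x \<longrightarrow> x \<in> \<Omega> i" using fg by blast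
    with le have eq: "f i = g x" by (intro antisym)
    then have "i \<in> minimizers f {0..L}" using i le by (simp add: mem_minimizers_iff)
    with i eq show ?thesis by blast
  qed
  with opt show "minimizers g UNIV = (\<Union>i \<in> minimizers f {0..L}. \<Omega> i)" by blast
  obtain i where i: "i \<in> minimizers f {0..L}"
    using minimizers_finite_ne[of "{0..L}" f] by auto
  obtain x where x: "x \<in> \<Omega> i" using ne by blast
  from opt[OF i x] show "minimizers g UNIV \<noteq> {}" by blast
  show "minimum (range g) = minimum (f ` {0..L})"
    using minimum_image_eq[OF opt[OF i x]] minimum_image_eq[OF i] g\<Omega>[OF x] by simp
qed

theorem theorem2p7:
  fixes A :: "real ^ 'n ^ 'm" and b :: "real ^ 'm" and p :: nat and \<phi> :: "real \<Rightarrow> real"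
  assumes "p \<in> {1, 2}"
    and "\<phi> \<in> {0..} \<rightarrow> {0..}"
    and "continuous_on {0..} \<phi>"
    and "mono_on {0..} \<phi>"
    and "\<phi> 0 = 0"
  shows "(\<forall>t>0. minimizers (objective A b p \<phi> t) UNIV \<noteq> {}) \<and>
    (\<forall>t>0.
      minimum (range (objective A b p \<phi> t))
        = minimum ((\<lambda>i. iter_f A b p \<phi> i t) ` {0..iter_L A b p \<phi>}) \<and>
      minimizers (objective A b p \<phi> t) UNIV
        = (\<Union>i \<in> minimizers (\<lambda>i. iter_f A b p \<phi> i t) {0..iter_L A b p \<phi>}. iter_Omega A b p \<phi> i))"
proof -
  have p: "p > 0" using assms(1) by auto
  \<comment> \<open>These equations give both functions the form that \<open>g\<close> and
    \<open>f\<close> take in the scalarization lemma.\<close>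
  have obj: "objective A b p \<phi> t = (\<lambda>x. real (l0 x) + t * loss A b p \<phi> x)"
    and f: "(\<lambda>i. iter_f A b p \<phi> i t)
      = (\<lambda>i. real (iter_s A b p \<phi> i) + t * iter_rho A b p \<phi> i)" for t
    by (simp_all add: fun_eq_iff objective_def iter_f_def)
  note sc = dominating_pairs_scalarization[where F = "loss A b p \<phi>" and c = l0
      and \<Omega> = "iter_Omega A b p \<phi>" and s = "iter_s A b p \<phi>" and \<rho> = "iter_rho A b p \<phi>"
      and L = "iter_L A b p \<phi>", OF iter_Omega_eq[OF p assms(4)] iter_dominates[OF p assms(4)]]
  show ?thesis unfolding obj f using sc by blast
qed

end
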